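(* Let $A$ be a local ring with unique maximal ideal $M$, let $E$ be a nonzero $A$-module such that $ME=0$, let $R=A\propto E$ and let $n$ be a positive integer. The following are equivalent. (1) $R$ is an $n$-OAF-ring. (2) $M^n=0$. (3) Every proper ideal of $R$ is an $n$-OA ideal.
   Context: All rings are commutative with $1\neq 0$. A local ring is a ring with a unique maximal ideal (not assumed Noetherian). The trivial extension $A\propto E$ is the additive group $A\oplus E$ with multiplication $(a,e)(b,f)=(ab,af+be)$. A proper ideal $I$ of a ring $R$ is an $n$-OA ideal if whenever $a_1a_2\cdots a_{n+1}\in I$ for nonunits $a_1,\ldots,a_{n+1}\in R$, then $a_1a_2\cdots a_n\in I$ or $a_{n+1}\in I$. A ring $R$ is an $n$-OAF-ring if every proper ideal of $R$ is a product of finitely many $n$-OA ideals of $R$.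
   Formalization: The implication (2)⇒(3) is stated only for n ≥ 2, since it fails for n = 1 when A is a field: M = 0, but the zero ideal of R is not 1-OA because (0,e)² = 0 for e ≠ 0; (1)⇒(2) and (3)⇒(1) are stated for all n ≥ 1. *)

theory Defs
  imports "HOL-Algebra.Module" "HOL-Algebra.Ideal_Product"
begin

text \<open>A maximal ideal is proper, so \<open>\<one> \<noteq> \<zero>\<close> holds in every local ring.\<close>

definition local_ring :: "('a, 'm) ring_scheme \<Rightarrow> bool" where
  "local_ring A \<longleftrightarrow> cring A \<and> (\<exists>!M. maximalideal M A)"

definition trivial_extension ::
    "('a, 'm) ring_scheme \<Rightarrow> ('a, 'e, 'k) module_scheme \<Rightarrow> ('a \<times> 'e) ring"
    (infixl \<open>\<propto>\<close> 65) where
  "A \<propto> E =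
    \<lparr> carrier = carrier A \<times> carrier E,
      mult = (\<lambda>(a, e) (b, f). (a \<otimes>\<^bsub>A\<^esub> b, (a \<odot>\<^bsub>E\<^esub> f) \<oplus>\<^bsub>E\<^esub> (b \<odot>\<^bsub>E\<^esub> e))),
      one = (\<one>\<^bsub>A\<^esub>, \<zero>\<^bsub>E\<^esub>),
      zero = (\<zero>\<^bsub>A\<^esub>, \<zero>\<^bsub>E\<^esub>),
      add = (\<lambda>(a, e) (b, f). (a \<oplus>\<^bsub>A\<^esub> b, e \<oplus>\<^bsub>E\<^esub> f)) \<rparr>"

lemma trivial_extension_cring:
  fixes A :: "('a, 'm) ring_scheme" and E :: "('a, 'e, 'k) module_scheme"
  assumes "module A E"
  shows "cring (A \<propto> E)"
proof -
  interpret module A E by fact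
  show ?thesis
  proof (rule cringI)
    show "abelian_group (A \<propto> E)"
    proof (rule abelian_groupI)
      fix x assume "x \<in> carrier (A \<propto> E)"
      then obtain a e where "x = (a, e)" "a \<in> carrier A" "e \<in> carrier E"
        by (auto simp: trivial_extension_def)
      then show "\<exists>y\<in>carrier (A \<propto> E). y \<oplus>\<^bsub>A \<propto> E\<^esub> x = \<zero>\<^bsub>A \<propto> E\<^esub>"
        by (intro bexI[of _ "(\<ominus>\<^bsub>A\<^esub> a, \<ominus>\<^bsub>E\<^esub> e)"])
           (auto simp: trivial_extension_def R.l_neg M.l_neg)
    qed (auto simp: trivial_extension_def R.a_ac M.a_ac)
    show "comm_monoid (A \<propto> E)"
      by (rule comm_monoidI)
         (auto simp: trivial_extension_def R.m_ac M.a_ac smult_r_distr smult_assoc1[symmetric]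
            simp del: smult_assoc1)
  qed (auto simp: trivial_extension_def R.l_distr smult_l_distr smult_r_distr M.a_ac)
qed

definition proper_ideal :: "'a set \<Rightarrow> ('a, 'm) ring_scheme \<Rightarrow> bool" where
  "proper_ideal I R \<longleftrightarrow> ideal I R \<and> I \<noteq> carrier R"

definition OA_ideal :: "nat \<Rightarrow> 'a set \<Rightarrow> ('a, 'm) ring_scheme \<Rightarrow> bool" where
  "OA_ideal n I R \<longleftrightarrow> proper_ideal I R \<and>
     (\<forall>a \<in> {1..n+1} \<rightarrow> carrier R - Units R.
        (\<Otimes>\<^bsub>R\<^esub>i\<in>{1..n+1}. a i) \<in> I \<longrightarrow> (\<Otimes>\<^bsub>R\<^esub>i\<in>{1..n}. a i) \<in> I \<or> a (n+1) \<in> I)"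

text \<open>
  For \<open>n = 1\<close> the zero ideal of \<open>A \<propto> E\<close> is never an \<open>n\<close>-OA ideal when \<open>E \<noteq> 0\<close>: a nonzero
  \<open>(0, e)\<close> squares to zero. If \<open>A\<close> is moreover a field, then \<open>M\<^sup>1 = 0\<close>, so that \<open>M\<^sup>n = 0\<close> does not
  imply that every proper ideal is an \<open>n\<close>-OA ideal unless \<open>n \<ge> 2\<close>.
\<close>

lemma trivial_extension_zero_not_OA_ideal_1:
  fixes A :: "('a, 'm) ring_scheme" and E :: "('a, 'e, 'k) module_scheme"
  assumes "module A E" and "carrier E \<noteq> {\<zero>\<^bsub>E\<^esub>}"
  shows "proper_ideal {\<zero>\<^bsub>A \<propto> E\<^esub>} (A \<propto> E)" and "\<not> OA_ideal 1 {\<zero>\<^bsub>A \<propto> E\<^esub>} (A \<propto> E)"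
proof -
  interpret module A E by fact
  interpret T: cring "A \<propto> E" by (rule trivial_extension_cring) fact
  obtain e where e: "e \<in> carrier E" "e \<noteq> \<zero>\<^bsub>E\<^esub>"
    using assms(2) M.zero_closed by blast
  have one: "\<one>\<^bsub>A\<^esub> \<noteq> \<zero>\<^bsub>A\<^esub>"
    using e by (metis smult_one smult_l_null)
  let ?x = "(\<zero>\<^bsub>A\<^esub>, e)"
  have x: "?x \<in> carrier (A \<propto> E)" "?x \<noteq> \<zero>\<^bsub>A \<propto> E\<^esub>"
    using e by (auto simp: trivial_extension_def)
  have sq: "?x \<otimes>\<^bsub>A \<propto> E\<^esub> ?x = \<zero>\<^bsub>A \<propto> E\<^esub>"
    using e by (auto simp: trivial_extension_def)
  have nonunit: "?x \<notin> Units (A \<propto> E)"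
    using one by (auto simp: Units_def trivial_extension_def)
  show "proper_ideal {\<zero>\<^bsub>A \<propto> E\<^esub>} (A \<propto> E)"
    using x T.zeroideal by (auto simp: proper_ideal_def)
  have two: "{1..1+1} = {1, 2::nat}" by auto
  have "(\<Otimes>\<^bsub>A \<propto> E\<^esub>i\<in>{1..1+1::nat}. ?x) = \<zero>\<^bsub>A \<propto> E\<^esub>"
    unfolding two using x sq by simp
  moreover have "(\<Otimes>\<^bsub>A \<propto> E\<^esub>i\<in>{1..1::nat}. ?x) = ?x"
    using x by simp
  moreover have "(\<lambda>_. ?x) \<in> {1..1+1::nat} \<rightarrow> carrier (A \<propto> E) - Units (A \<propto> E)"
    using x nonunit by auto
  ultimately show "\<not> OA_ideal 1 {\<zero>\<^bsub>A \<propto> E\<^esub>} (A \<propto> E)"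
    using x unfolding OA_ideal_def by (metis singleton_iff)
qed

text \<open>
  Products are taken in the commutative monoid of ideals of \<open>R\<close>. The empty product is \<open>R\<close>
  itself, which is not proper, so admitting \<open>k = 0\<close> makes no difference.
\<close>

definition OAF_ring :: "nat \<Rightarrow> ('a, 'm) ring_scheme \<Rightarrow> bool" where
  "OAF_ring n R \<longleftrightarrow> cring R \<and> \<one>\<^bsub>R\<^esub> \<noteq> \<zero>\<^bsub>R\<^esub> \<and>
     (\<forall>I. proper_ideal I R \<longrightarrow>
        (\<exists>(k::nat) J. (\<forall>i\<in>{1..k}. OA_ideal n (J i) R) \<and>
           I = (\<Otimes>\<^bsub>ideals_set R\<^esub>i\<in>{1..k}. J i)))"

end

theory Submission
  imports "HOL-Algebra.Ring_Divisibility" Defs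
begin

text \<open>
  The engine is that \<open>M\<close> kills \<open>E\<close>. The nonunits of \<open>R = A \<propto> E\<close> are the pairs with first
  component in \<open>M\<close>, so two nonunits multiply as \<open>(a, e)(b, f) = (ab, 0)\<close>: every product of at
  least two nonunits, and hence every element of a product of at least two proper ideals, has
  second component zero (\<open>snd_mult_eq_zero\<close>, \<open>snd_eq_zero_of_proper_ideal_prod\<close>).

  Suppose \<open>R\<close> is an \<open>n\<close>-OAF-ring, let \<open>p = a\<^sub>1 \<cdots> a\<^sub>n\<close> with \<open>a\<^sub>i \<in> M\<close>, and fix a nonzero
  \<open>e \<in> E\<close>. The principal ideal \<open>I = R(p, e)\<close> contains an element with nonzero second
  component, so every factorization of \<open>I\<close> has a single factor, and \<open>I\<close> itself is
  an \<open>n\<close>-OA ideal. Since \<open>(a\<^sub>1, 0) \<cdots> (a\<^sub>n, 0)(0, e) = 0\<close> lies in \<open>I\<close>, one of \<open>(p, 0)\<close> and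
  \<open>(0, e)\<close> is a multiple \<open>(cp, ce)\<close> of \<open>(p, e)\<close>. In the first case \<open>ce = 0\<close> makes \<open>c\<close> a nonunit,
  so \<open>1 - c\<close> is a unit and \<open>p = cp\<close> gives \<open>p = 0\<close>; in the second case \<open>ce = e\<close> makes \<open>c\<close> a
  unit and \<open>cp = 0\<close> gives \<open>p = 0\<close>. As \<open>M\<^sup>n\<close> is generated by such products, it vanishes.

  Conversely, if \<open>M\<^sup>n = 0\<close> with \<open>n \<ge> 2\<close>, then the product of any \<open>n\<close> nonunits of \<open>R\<close> is zero,
  so the defining condition of an \<open>n\<close>-OA ideal holds because its conclusion always does.
  Finally, an \<open>n\<close>-OA ideal is a one-factor product of \<open>n\<close>-OA ideals.
\<close>

section \<open>Maximal ideals and units\<close>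

text \<open>
  Zorn's lemma, applied to the ideals that contain \<open>I\<close> and avoid \<open>\<one>\<close>; the union of a chain of
  such ideals is again one.
\<close>

lemma (in ring) proper_ideal_subset_maximalideal:
  assumes "ideal I R" "\<one> \<notin> I"
  shows "\<exists>N. maximalideal N R \<and> I \<subseteq> N"
proof -
  define S where "S = {J. ideal J R \<and> I \<subseteq> J \<and> \<one> \<notin> J}"
  have "\<exists>N\<in>S. \<forall>J\<in>S. N \<subseteq> J \<longrightarrow> J = N"
  proof (rule subset_Zorn)
    fix C assume C: "subset.chain S C"
    show "\<exists>U\<in>S. \<forall>J\<in>C. J \<subseteq> U"
    proof (cases "C = {}")
      case True
      then show ?thesis using assms by (auto simp: S_def)
    next
      case False
      have CS: "C \<subseteq> S" using C by (auto simp: pred_on.chain_def)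
      have "subset.chain {J. ideal J R} C"
        using C by (auto simp: pred_on.chain_def S_def)
      then have "ideal (\<Union>C) R" using chain_Union_is_ideal[of C] False by simp
      moreover have "I \<subseteq> \<Union>C" "\<one> \<notin> \<Union>C" using CS False by (auto simp: S_def)
      ultimately show ?thesis by (intro bexI[of _ "\<Union>C"]) (auto simp: S_def)
    qed
  qed
  then obtain N where N: "N \<in> S" and N_max: "\<And>J. J \<in> S \<Longrightarrow> N \<subseteq> J \<Longrightarrow> J = N" by blast
  have "maximalideal N R"
  proof (rule maximalidealI)
    show "ideal N R" "carrier R \<noteq> N" using N by (auto simp: S_def)
    fix J assume J: "ideal J R" "N \<subseteq> J" "J \<subseteq> carrier R"
    show "J = N \<or> J = carrier R"
    proof (cases "\<one> \<in> J")
      case True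
      then show ?thesis using ideal.one_imp_carrier[OF J(1)] by simp
    next
      case False
      then have "J \<in> S" using J N by (auto simp: S_def)
      then show ?thesis using N_max J by blast
    qed
  qed
  then show ?thesis using N by (auto simp: S_def)
qed

lemma (in ring) Units_notin_ideal:
  assumes "ideal I R" "\<one> \<notin> I" "u \<in> Units R"
  shows "u \<notin> I"
  using ideal.I_l_closed[OF assms(1), of u "inv u"] assms by auto

lemma proper_ideal_one_notin:
  assumes "proper_ideal I R"
  shows "\<one>\<^bsub>R\<^esub> \<notin> I"
  using assms ideal.one_imp_carrier by (auto simp: proper_ideal_def)

text \<open>
  A nonunit generates a proper ideal, which lies in some maximal ideal, and there is only one.
\<close>

lemma local_ring_Units:
  fixes A (structure)
  assumes "local_ring A" "maximalideal M A"
  shows "Units A = carrier A - M"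
proof -
  interpret cring A using assms(1) by (simp add: local_ring_def)
  interpret M: maximalideal M A by fact
  have one: "\<one> \<notin> M" using M.one_imp_carrier M.I_notcarr by blast
  have "a \<in> Units A" if a: "a \<in> carrier A" "a \<notin> M" for a
  proof (rule ccontr)
    assume nonunit: "a \<notin> Units A"
    have "\<one> \<notin> PIdl a"
    proof
      assume "\<one> \<in> PIdl a"
      then obtain x where "x \<in> carrier A" "x \<otimes> a = \<one>" by (auto simp: cgenideal_def)
      then show False using nonunit a by (auto simp: Units_def m_comm)
    qed
    then obtain N where "maximalideal N A" "PIdl a \<subseteq> N"
      using proper_ideal_subset_maximalideal cgenideal_ideal a by blast
    moreover from this have "N = M" using assms by (auto simp: local_ring_def)
    ultimately show False using cgenideal_self a by blast
  qed
  then show ?thesis using Units_notin_ideal[OF M.is_ideal one] by auto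
qed

section \<open>Products and powers of ideals\<close>

lemma ideals_set_simps:
  "carrier (ideals_set R) = {I. ideal I R}"
  "I \<otimes>\<^bsub>ideals_set R\<^esub> J = I \<cdot>\<^bsub>R\<^esub> J"
  "\<one>\<^bsub>ideals_set R\<^esub> = carrier R"
  by (simp_all add: ideals_set_def)

lemma (in comm_monoid) finprod_atLeastAtMost_1_Suc:
  assumes "f \<in> {1..Suc k} \<rightarrow> carrier G"
  shows "finprod G f {1..Suc k} = f (Suc k) \<otimes> finprod G f {1..k}"
  using assms by (subst atLeastAtMostSuc_conv) (auto simp: Pi_def)

lemma (in cring) finprod_ideals_proper:
  assumes "\<forall>i\<in>{1..k::nat}. proper_ideal (J i) R" "k > 0"
  shows "proper_ideal (\<Otimes>\<^bsub>ideals_set R\<^esub>i\<in>{1..k}. J i) R"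
proof -
  interpret I: comm_monoid "ideals_set R" by (rule ideals_set_is_comm_monoid)
  obtain l where k: "k = Suc l" using assms(2) gr0_implies_Suc by blast
  have J: "J \<in> {1..Suc l} \<rightarrow> carrier (ideals_set R)"
    using assms(1) k by (auto simp: ideals_set_simps proper_ideal_def)
  let ?P = "\<Otimes>\<^bsub>ideals_set R\<^esub>i\<in>{1..l}. J i"
  have "?P \<in> carrier (ideals_set R)" using J by (intro I.finprod_closed) auto
  then have P: "ideal ?P R" by (simp add: ideals_set_simps)
  have Jk: "proper_ideal (J k) R" using assms by auto
  have "(\<Otimes>\<^bsub>ideals_set R\<^esub>i\<in>{1..k}. J i) = J k \<cdot> ?P"
    unfolding k I.finprod_atLeastAtMost_1_Suc[OF J] by (simp add: ideals_set_simps)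
  moreover have "J k \<cdot> ?P \<subseteq> J k" "ideal (J k \<cdot> ?P) R"
    using ideal_prod_inter[of "J k" ?P] ideal_prod_is_ideal[of "J k" ?P] Jk P
    by (auto simp: proper_ideal_def)
  ultimately show ?thesis
    using proper_ideal_one_notin[OF Jk] by (auto simp: proper_ideal_def)
qed

text \<open>
  The factor \<open>c\<close> is what makes the induction on \<open>n\<close> work: it absorbs the last factor of each
  generator of \<open>M\<^sup>n\<^sup>+\<^sup>1\<close>.
\<close>

lemma (in cring) mult_ideal_power_eq_zero:
  assumes "ideal M R" "c \<in> carrier R"
    and "\<And>a. a \<in> {1..n::nat} \<rightarrow> M \<Longrightarrow> c \<otimes> (\<Otimes>i\<in>{1..n}. a i) = \<zero>"
    and "x \<in> M [^]\<^bsub>ideals_set R\<^esub> n"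
  shows "c \<otimes> x = \<zero>"
  using assms(2-)
proof (induction n arbitrary: c x)
  case 0
  then have "c = \<zero>" "x \<in> carrier R" by (auto simp: ideals_set_simps nat_pow_def)
  then show ?case by simp
next
  case (Suc n)
  interpret I: comm_monoid "ideals_set R" by (rule ideals_set_is_comm_monoid)
  have M: "M \<in> carrier (ideals_set R)" using assms(1) by (simp add: ideals_set_simps)
  have Mc: "M \<subseteq> carrier R" using assms(1) by (simp add: additive_subgroup.a_subset ideal.axioms(1))
  have Mn: "ideal (M [^]\<^bsub>ideals_set R\<^esub> n) R"
    using I.nat_pow_closed[OF M, of n] by (simp add: ideals_set_simps)
  have Mnc: "M [^]\<^bsub>ideals_set R\<^esub> n \<subseteq> carrier R"
    using Mn by (simp add: additive_subgroup.a_subset ideal.axioms(1))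
  have "x \<in> (M [^]\<^bsub>ideals_set R\<^esub> n) \<cdot> M"
    using Suc.prems(3) by (simp add: ideals_set_simps)
  then have "x \<in> carrier R \<and> c \<otimes> x = \<zero>"
  proof induction
    case (prod y m)
    have y: "y \<in> carrier R" and m: "m \<in> carrier R" using prod Mc Mnc by auto
    \<comment> \<open>Placing \<open>m\<close> at position \<open>n + 1\<close> turns a product of \<open>n\<close> elements of \<open>M\<close> into one of
      \<open>n + 1\<close>, so \<open>cm\<close> satisfies the hypothesis for \<open>n\<close>.\<close>
    have "c \<otimes> m \<otimes> (\<Otimes>i\<in>{1..n}. a i) = \<zero>" if a: "a \<in> {1..n} \<rightarrow> M" for a
    proof -
      let ?b = "a(Suc n := m)"
      have b: "?b \<in> {1..Suc n} \<rightarrow> M" using a prod by (auto simp: Pi_def)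
      have "(\<Otimes>i\<in>{1..Suc n}. ?b i) = ?b (Suc n) \<otimes> (\<Otimes>i\<in>{1..n}. ?b i)"
        using b Mc by (intro finprod_atLeastAtMost_1_Suc) auto
      also have "(\<Otimes>i\<in>{1..n}. ?b i) = (\<Otimes>i\<in>{1..n}. a i)"
        using a Mc by (intro finprod_cong') auto
      finally have "c \<otimes> (m \<otimes> (\<Otimes>i\<in>{1..n}. a i)) = \<zero>" using Suc.prems(2)[OF b] by simp
      moreover have "(\<Otimes>i\<in>{1..n}. a i) \<in> carrier R" using a Mc by (intro finprod_closed) auto
      ultimately show ?thesis using Suc.prems(1) m by (simp add: m_assoc)
    qed
    then have "c \<otimes> m \<otimes> y = \<zero>" using Suc.IH[of "c \<otimes> m" y] Suc.prems(1) m prod by blast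
    then show ?case using Suc.prems(1) m y by (simp add: m_ac)
  next
    case (sum s t)
    then show ?case using Suc.prems(1) by (simp add: r_distr)
  qed
  then show ?case by simp
qed

lemma (in cring) finprod_in_ideal_power:
  assumes "ideal M R" "a \<in> {1..n::nat} \<rightarrow> M"
  shows "(\<Otimes>i\<in>{1..n}. a i) \<in> M [^]\<^bsub>ideals_set R\<^esub> n"
  using assms(2)
proof (induction n)
  case 0
  then show ?case by (simp add: ideals_set_simps)
next
  case (Suc n)
  have Mc: "M \<subseteq> carrier R" using assms by (simp add: additive_subgroup.a_subset ideal.axioms(1))
  have "(\<Otimes>i\<in>{1..n}. a i) \<in> M [^]\<^bsub>ideals_set R\<^esub> n" using Suc by (auto simp: Pi_def)
  then have "(\<Otimes>i\<in>{1..n}. a i) \<otimes> a (Suc n) \<in> (M [^]\<^bsub>ideals_set R\<^esub> n) \<cdot> M"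
    using Suc.prems by (intro ideal_prod.prod) auto
  moreover have "(\<Otimes>i\<in>{1..Suc n}. a i) = a (Suc n) \<otimes> (\<Otimes>i\<in>{1..n}. a i)"
    using Suc.prems Mc by (intro finprod_atLeastAtMost_1_Suc) auto
  moreover have "(\<Otimes>i\<in>{1..n}. a i) \<in> carrier R" "a (Suc n) \<in> carrier R"
    using Suc.prems Mc by (auto intro!: finprod_closed)
  ultimately show ?case by (simp add: ideals_set_simps m_comm)
qed

lemma (in cring) ideal_power_eq_zero_iff:
  assumes "ideal M R"
  shows "M [^]\<^bsub>ideals_set R\<^esub> n = {\<zero>} \<longleftrightarrow> (\<forall>a\<in>{1..n::nat} \<rightarrow> M. (\<Otimes>i\<in>{1..n}. a i) = \<zero>)"
proof
  assume zero: "M [^]\<^bsub>ideals_set R\<^esub> n = {\<zero>}"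
  show "\<forall>a\<in>{1..n} \<rightarrow> M. (\<Otimes>i\<in>{1..n}. a i) = \<zero>"
  proof
    fix a assume "a \<in> {1..n} \<rightarrow> M"
    from finprod_in_ideal_power[OF assms this] show "(\<Otimes>i\<in>{1..n}. a i) = \<zero>"
      unfolding zero by (rule singletonD)
  qed
next
  interpret I: comm_monoid "ideals_set R" by (rule ideals_set_is_comm_monoid)
  have "M \<in> carrier (ideals_set R)" using assms by (simp add: ideals_set_simps)
  then have Mn: "ideal (M [^]\<^bsub>ideals_set R\<^esub> n) R"
    using I.nat_pow_closed[of M n] by (simp add: ideals_set_simps)
  assume prods: "\<forall>a\<in>{1..n} \<rightarrow> M. (\<Otimes>i\<in>{1..n}. a i) = \<zero>"
  have "x = \<zero>" if x: "x \<in> M [^]\<^bsub>ideals_set R\<^esub> n" for x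
  proof -
    have "\<one> \<otimes> x = \<zero>"
      using assms one_closed _ x
    proof (rule mult_ideal_power_eq_zero)
      show "\<one> \<otimes> (\<Otimes>i\<in>{1..n}. a i) = \<zero>" if "a \<in> {1..n} \<rightarrow> M" for a
        using bspec[OF prods that] by (metis r_null one_closed)
    qed
    moreover have "x \<in> carrier R" using x ideal.Icarr[OF Mn] by blast
    ultimately show ?thesis by simp
  qed
  then show "M [^]\<^bsub>ideals_set R\<^esub> n = {\<zero>}"
    using additive_subgroup.zero_closed[OF ideal.axioms(1)[OF Mn]] by blast
qed

section \<open>Trivial extensions by a module killed by the maximal ideal\<close>

lemma trivial_extension_carrier [simp]: "carrier (A \<propto> E) = carrier A \<times> carrier E"
  by (simp add: trivial_extension_def)

lemma trivial_extension_one [simp]: "\<one>\<^bsub>A \<propto> E\<^esub> = (\<one>\<^bsub>A\<^esub>, \<zero>\<^bsub>E\<^esub>)"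
  by (simp add: trivial_extension_def)

lemma trivial_extension_zero [simp]: "\<zero>\<^bsub>A \<propto> E\<^esub> = (\<zero>\<^bsub>A\<^esub>, \<zero>\<^bsub>E\<^esub>)"
  by (simp add: trivial_extension_def)

lemma trivial_extension_mult [simp]:
  "(a, e) \<otimes>\<^bsub>A \<propto> E\<^esub> (b, f) = (a \<otimes>\<^bsub>A\<^esub> b, (a \<odot>\<^bsub>E\<^esub> f) \<oplus>\<^bsub>E\<^esub> (b \<odot>\<^bsub>E\<^esub> e))"
  by (simp add: trivial_extension_def)

text \<open>The inverse of \<open>(u, e)\<close> is \<open>(u\<^sup>-\<^sup>1, - u\<^sup>-\<^sup>2 e)\<close>.\<close>

lemma trivial_extension_Units:
  assumes "module A E"
  shows "Units (A \<propto> E) = Units A \<times> carrier E"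
proof -
  interpret module A E by fact
  interpret T: cring "A \<propto> E" by (rule trivial_extension_cring) fact
  have "(u, e) \<in> Units (A \<propto> E)" if u: "u \<in> Units A" and e: "e \<in> carrier E" for u e
  proof -
    let ?v = "inv\<^bsub>A\<^esub> u"
    let ?y = "(?v, \<ominus>\<^bsub>E\<^esub> ((?v \<otimes>\<^bsub>A\<^esub> ?v) \<odot>\<^bsub>E\<^esub> e))"
    have uv: "u \<in> carrier A" "?v \<in> carrier A" "u \<otimes>\<^bsub>A\<^esub> ?v = \<one>\<^bsub>A\<^esub>" using u by auto
    have "u \<odot>\<^bsub>E\<^esub> (\<ominus>\<^bsub>E\<^esub> ((?v \<otimes>\<^bsub>A\<^esub> ?v) \<odot>\<^bsub>E\<^esub> e)) = \<ominus>\<^bsub>E\<^esub> ((u \<otimes>\<^bsub>A\<^esub> (?v \<otimes>\<^bsub>A\<^esub> ?v)) \<odot>\<^bsub>E\<^esub> e)"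
      using uv e by (simp add: smult_r_minus smult_assoc1)
    also have "u \<otimes>\<^bsub>A\<^esub> (?v \<otimes>\<^bsub>A\<^esub> ?v) = ?v" using uv by (simp add: R.m_assoc[symmetric])
    finally have "(u, e) \<otimes>\<^bsub>A \<propto> E\<^esub> ?y = \<one>\<^bsub>A \<propto> E\<^esub>" using uv e by (simp add: M.l_neg)
    moreover have "(u, e) \<in> carrier (A \<propto> E)" "?y \<in> carrier (A \<propto> E)" using uv e by auto
    ultimately show ?thesis using T.m_comm unfolding Units_def by fastforce
  qed
  moreover have "Units (A \<propto> E) \<subseteq> Units A \<times> carrier E" by (auto simp: Units_def)
  ultimately show ?thesis by blast
qed

text \<open>
  The maximal ideal is called \<open>N\<close> because \<open>M\<close> already qualifies the facts about the additive
  group of \<open>E\<close>.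
\<close>

locale local_trivial_extension = module A E
  for A :: "('a, 'm) ring_scheme" (structure)
    and E :: "('a, 'e, 'k) module_scheme" (structure) +
  fixes N :: "'a set"
  assumes local: "local_ring A"
    and maximal: "maximalideal N A"
    and smult_maximal: "\<lbrakk>m \<in> N; e \<in> carrier E\<rbrakk> \<Longrightarrow> m \<odot>\<^bsub>E\<^esub> e = \<zero>\<^bsub>E\<^esub>"
begin

sublocale T: cring "A \<propto> E"
  by (rule trivial_extension_cring) (rule module_axioms)

sublocale N: maximalideal N A
  by (rule maximal)

lemma one_notin_maximal: "\<one>\<^bsub>A\<^esub> \<notin> N"
  using N.one_imp_carrier N.I_notcarr by blast

lemma one_not_zero: "\<one>\<^bsub>A\<^esub> \<noteq> \<zero>\<^bsub>A\<^esub>"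
  using one_notin_maximal N.zero_closed by auto

lemma nonunits: "carrier (A \<propto> E) - Units (A \<propto> E) = N \<times> carrier E"
  using trivial_extension_Units[OF module_axioms] local_ring_Units[OF local maximal] N.Icarr
  by auto

lemma proper_ideal_subset_nonunits:
  assumes "proper_ideal I (A \<propto> E)"
  shows "I \<subseteq> N \<times> carrier E"
  using T.Units_notin_ideal[of I] proper_ideal_one_notin[OF assms] assms ideal.Icarr[of I]
  unfolding nonunits[symmetric] proper_ideal_def by blast

lemma snd_mult_eq_zero:
  assumes "x \<in> N \<times> carrier E" "y \<in> N \<times> carrier E"
  shows "snd (x \<otimes>\<^bsub>A \<propto> E\<^esub> y) = \<zero>\<^bsub>E\<^esub>"
  using assms smult_maximal by auto

lemma snd_eq_zero_of_proper_ideal_prod: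
  assumes "proper_ideal I (A \<propto> E)" "proper_ideal J (A \<propto> E)"
    and "x \<in> I \<cdot>\<^bsub>A \<propto> E\<^esub> J"
  shows "snd x = \<zero>\<^bsub>E\<^esub>"
  using assms(3)
proof induction
  case (prod i j)
  then show ?case using assms(1,2) proper_ideal_subset_nonunits snd_mult_eq_zero by blast
next
  case (sum s t)
  then show ?case by (simp add: trivial_extension_def split_beta)
qed

text \<open>
  A factorization of \<open>I\<close> into two or more proper ideals would force \<open>snd x\<close> to be zero, so the
  factorization that the ring property supplies has \<open>I\<close> as its only factor.
\<close>

lemma OA_ideal_of_OAF_ring:
  assumes "OAF_ring n (A \<propto> E)" "proper_ideal I (A \<propto> E)"
    and "x \<in> I" "snd x \<noteq> \<zero>\<^bsub>E\<^esub>"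
  shows "OA_ideal n I (A \<propto> E)"
proof -
  interpret S: comm_monoid "ideals_set (A \<propto> E)" by (rule T.ideals_set_is_comm_monoid)
  obtain k :: nat and J where J: "\<forall>i\<in>{1..k}. OA_ideal n (J i) (A \<propto> E)"
    and I: "I = (\<Otimes>\<^bsub>ideals_set (A \<propto> E)\<^esub>i\<in>{1..k}. J i)"
    using assms(1,2) unfolding OAF_ring_def by blast
  have J_proper: "\<forall>i\<in>{1..k}. proper_ideal (J i) (A \<propto> E)" using J by (auto simp: OA_ideal_def)
  then have Jc: "J \<in> {1..k} \<rightarrow> carrier (ideals_set (A \<propto> E))"
    by (auto simp: ideals_set_simps proper_ideal_def)
  consider "k = 0" | "k = 1" | l where "k = Suc l" "l > 0"
    by (metis One_nat_def not0_implies_Suc neq0_conv)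
  then show ?thesis
  proof cases
    case 1
    then have "I = carrier (A \<propto> E)" using I by (simp add: ideals_set_simps)
    then show ?thesis using assms(2) by (simp add: proper_ideal_def)
  next
    case 2
    then have "I = J 1" using I Jc by simp
    then show ?thesis using J 2 by simp
  next
    case 3
    let ?P = "\<Otimes>\<^bsub>ideals_set (A \<propto> E)\<^esub>i\<in>{1..l}. J i"
    have "I = J k \<otimes>\<^bsub>ideals_set (A \<propto> E)\<^esub> ?P"
      unfolding I 3(1) using Jc 3(1) by (intro S.finprod_atLeastAtMost_1_Suc) simp
    then have "x \<in> J k \<cdot>\<^bsub>A \<propto> E\<^esub> ?P" using assms(3) by (simp add: ideals_set_simps)
    moreover have "proper_ideal ?P (A \<propto> E)"
      using J_proper 3 by (intro T.finprod_ideals_proper) auto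
    moreover have "proper_ideal (J k) (A \<propto> E)" using J_proper 3 by auto
    ultimately show ?thesis using snd_eq_zero_of_proper_ideal_prod assms(4) by blast
  qed
qed

lemma fst_finprod:
  assumes "x \<in> {1..k::nat} \<rightarrow> carrier (A \<propto> E)"
  shows "fst (\<Otimes>\<^bsub>A \<propto> E\<^esub>i\<in>{1..k}. x i) = (\<Otimes>\<^bsub>A\<^esub>i\<in>{1..k}. fst (x i))"
  using assms
proof (induction k)
  case 0
  then show ?case by simp
next
  case (Suc k)
  have "(\<Otimes>\<^bsub>A \<propto> E\<^esub>i\<in>{1..Suc k}. x i) = x (Suc k) \<otimes>\<^bsub>A \<propto> E\<^esub> (\<Otimes>\<^bsub>A \<propto> E\<^esub>i\<in>{1..k}. x i)"
    using Suc.prems by (rule T.finprod_atLeastAtMost_1_Suc)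
  then have "fst (\<Otimes>\<^bsub>A \<propto> E\<^esub>i\<in>{1..Suc k}. x i) =
      fst (x (Suc k)) \<otimes>\<^bsub>A\<^esub> fst (\<Otimes>\<^bsub>A \<propto> E\<^esub>i\<in>{1..k}. x i)"
    by (simp add: trivial_extension_def split_beta)
  moreover have "(\<Otimes>\<^bsub>A\<^esub>i\<in>{1..Suc k}. fst (x i)) =
      fst (x (Suc k)) \<otimes>\<^bsub>A\<^esub> (\<Otimes>\<^bsub>A\<^esub>i\<in>{1..k}. fst (x i))"
    using Suc.prems by (intro R.finprod_atLeastAtMost_1_Suc) (auto simp: Pi_iff mem_Times_iff)
  moreover have "x \<in> {1..k} \<rightarrow> carrier (A \<propto> E)" using Suc.prems by (auto simp: Pi_iff)
  ultimately show ?case using Suc.IH by simp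
qed

lemma finprod_nonunits:
  assumes "x \<in> {1..k::nat} \<rightarrow> N \<times> carrier E" "k > 0"
  shows "(\<Otimes>\<^bsub>A \<propto> E\<^esub>i\<in>{1..k}. x i) \<in> N \<times> carrier E"
    and "k \<ge> 2 \<Longrightarrow> snd (\<Otimes>\<^bsub>A \<propto> E\<^esub>i\<in>{1..k}. x i) = \<zero>\<^bsub>E\<^esub>"
proof -
  have NE: "N \<times> carrier E \<subseteq> carrier (A \<propto> E)" using N.Icarr by auto
  have mult_closed: "u \<otimes>\<^bsub>A \<propto> E\<^esub> v \<in> N \<times> carrier E"
    if "u \<in> N \<times> carrier E" "v \<in> N \<times> carrier E" for u v
    using that N.I_r_closed N.Icarr by auto
  have step: "(\<Otimes>\<^bsub>A \<propto> E\<^esub>i\<in>{1..Suc k}. x i) = x (Suc k) \<otimes>\<^bsub>A \<propto> E\<^esub> (\<Otimes>\<^bsub>A \<propto> E\<^esub>i\<in>{1..k}. x i)"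
    if "x \<in> {1..Suc k} \<rightarrow> N \<times> carrier E" for k
    using that NE by (intro T.finprod_atLeastAtMost_1_Suc) blast
  have closed: "(\<Otimes>\<^bsub>A \<propto> E\<^esub>i\<in>{1..Suc k}. x i) \<in> N \<times> carrier E"
    if "x \<in> {1..Suc k} \<rightarrow> N \<times> carrier E" for k
    using that
  proof (induction k)
    case 0
    then have x1: "x (Suc 0) \<in> N \<times> carrier E" by auto
    have "(\<Otimes>\<^bsub>A \<propto> E\<^esub>i\<in>{1..0::nat}. x i) = \<one>\<^bsub>A \<propto> E\<^esub>"
      by (simp del: trivial_extension_one)
    moreover have "x (Suc 0) \<otimes>\<^bsub>A \<propto> E\<^esub> \<one>\<^bsub>A \<propto> E\<^esub> = x (Suc 0)"
      using subsetD[OF NE x1] by (rule T.r_one)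
    ultimately show ?case unfolding step[OF 0] using x1 by (simp only:)
  next
    case (Suc k)
    then have "x \<in> {1..Suc k} \<rightarrow> N \<times> carrier E" "x (Suc (Suc k)) \<in> N \<times> carrier E"
      by (auto simp: Pi_iff)
    then show ?case unfolding step[OF Suc.prems] by (intro mult_closed Suc.IH)
  qed
  show "(\<Otimes>\<^bsub>A \<propto> E\<^esub>i\<in>{1..k}. x i) \<in> N \<times> carrier E"
    using closed[of "k - 1"] assms by simp
  show "snd (\<Otimes>\<^bsub>A \<propto> E\<^esub>i\<in>{1..k}. x i) = \<zero>\<^bsub>E\<^esub>" if k2: "k \<ge> 2"
  proof -
    obtain l where k: "k = Suc (Suc l)"
      using le_Suc_ex[OF k2] by (auto simp: add_2_eq_Suc)
    have x: "x \<in> {1..Suc (Suc l)} \<rightarrow> N \<times> carrier E" using assms(1) unfolding k .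
    have "x \<in> {1..Suc l} \<rightarrow> N \<times> carrier E" using x by (rule subsetD[OF Pi_anti_mono, rotated]) simp
    moreover have "x (Suc (Suc l)) \<in> N \<times> carrier E" using x by (rule Pi_mem) simp
    ultimately show ?thesis unfolding k step[OF x] by (intro snd_mult_eq_zero closed)
  qed
qed

text \<open>
  To show that a product \<open>p\<close> of \<open>n\<close> elements of the maximal ideal is zero, the \<open>n\<close>-OA condition is
  tested on the principal ideal of \<open>(p, e)\<close>. The component \<open>e \<noteq> 0\<close> makes this ideal
  indecomposable, and since \<open>p\<close> kills \<open>E\<close>, a multiple of \<open>(p, e)\<close> is always of the form
  \<open>(cp, ce)\<close>, so that membership in it can be read off componentwise.
\<close>

lemma maximal_power_eq_zero_of_OAF_ring:
  assumes "OAF_ring n (A \<propto> E)" "carrier E \<noteq> {\<zero>\<^bsub>E\<^esub>}" "n > 0"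
  shows "N [^]\<^bsub>ideals_set A\<^esub> n = {\<zero>\<^bsub>A\<^esub>}"
  unfolding R.ideal_power_eq_zero_iff[OF N.is_ideal]
proof
  fix a assume a: "a \<in> {1..n} \<rightarrow> N"
  obtain e where e: "e \<in> carrier E" "e \<noteq> \<zero>\<^bsub>E\<^esub>" using assms(2) M.zero_closed by blast
  define p where "p = (\<Otimes>\<^bsub>A\<^esub>i\<in>{1..n}. a i)"
  define x where "x i = (if i = n + 1 then (\<zero>\<^bsub>A\<^esub>, e) else (a i, \<zero>\<^bsub>E\<^esub>))" for i
  define I where "I = PIdl\<^bsub>A \<propto> E\<^esub> (p, e)"
  have x: "x \<in> {1..n+1} \<rightarrow> N \<times> carrier E" using a e by (auto simp: x_def Pi_iff)
  then have xn: "x \<in> {1..n} \<rightarrow> N \<times> carrier E" by (auto simp: Pi_iff)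
  have prod_x: "(\<Otimes>\<^bsub>A \<propto> E\<^esub>i\<in>{1..n}. x i) = (p, \<zero>\<^bsub>E\<^esub>)" and pN: "p \<in> N"
  proof -
    have "(\<Otimes>\<^bsub>A \<propto> E\<^esub>i\<in>{1..n}. x i) \<in> N \<times> carrier E" using finprod_nonunits(1)[OF xn assms(3)] .
    moreover have fst: "fst (\<Otimes>\<^bsub>A \<propto> E\<^esub>i\<in>{1..n}. x i) = p"
    proof -
      have "(\<Otimes>\<^bsub>A\<^esub>i\<in>{1..n}. fst (x i)) = p"
        unfolding p_def using a N.Icarr by (intro R.finprod_cong') (auto simp: x_def Pi_iff)
      then show ?thesis using fst_finprod[of x n] xn N.Icarr by (auto simp: Pi_iff mem_Times_iff)
    qed
    moreover have "snd (\<Otimes>\<^bsub>A \<propto> E\<^esub>i\<in>{1..n}. x i) = \<zero>\<^bsub>E\<^esub>"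
    proof (cases "n = 1")
      case True
      then have "x 1 \<in> carrier (A \<propto> E)" using xn N.Icarr by (auto simp: mem_Times_iff)
      then show ?thesis using True by (simp add: x_def)
    next
      case False
      then show ?thesis using finprod_nonunits(2)[OF xn assms(3)] assms(3) by linarith
    qed
    ultimately show "(\<Otimes>\<^bsub>A \<propto> E\<^esub>i\<in>{1..n}. x i) = (p, \<zero>\<^bsub>E\<^esub>)" "p \<in> N"
      by (auto simp: prod_eq_iff mem_Times_iff)
  qed
  have p: "p \<in> carrier A" using pN N.Icarr by blast
  have I_elem: "\<exists>c\<in>carrier A. c \<otimes>\<^bsub>A\<^esub> p = fst y \<and> c \<odot>\<^bsub>E\<^esub> e = snd y" if "y \<in> I" for y
    using that pN smult_maximal e by (auto simp: I_def cgenideal_def)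
  have I: "ideal I (A \<propto> E)" unfolding I_def using p e by (intro T.cgenideal_ideal) simp
  have "\<one>\<^bsub>A \<propto> E\<^esub> \<notin> I"
    using I_elem pN N.I_l_closed one_notin_maximal by fastforce
  then have I_proper: "proper_ideal I (A \<propto> E)"
    using I T.one_closed by (auto simp: proper_ideal_def)
  have "(p, e) \<in> I" unfolding I_def using p e by (intro T.cgenideal_self) simp
  then have OA: "OA_ideal n I (A \<propto> E)"
    using OA_ideal_of_OAF_ring[OF assms(1) I_proper] e by auto
  have "(\<Otimes>\<^bsub>A \<propto> E\<^esub>i\<in>{1..n+1}. x i) = x (Suc n) \<otimes>\<^bsub>A \<propto> E\<^esub> (\<Otimes>\<^bsub>A \<propto> E\<^esub>i\<in>{1..n}. x i)"
    using x N.Icarr T.finprod_atLeastAtMost_1_Suc[of x n] by (auto simp: Pi_iff mem_Times_iff)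
  also have "\<dots> = \<zero>\<^bsub>A \<propto> E\<^esub>"
    unfolding prod_x using p e smult_maximal[OF pN] by (simp add: x_def)
  finally have "(\<Otimes>\<^bsub>A \<propto> E\<^esub>i\<in>{1..n+1}. x i) \<in> I"
    using additive_subgroup.zero_closed[OF ideal.axioms(1)[OF I]] by simp
  moreover have "x \<in> {1..n+1} \<rightarrow> carrier (A \<propto> E) - Units (A \<propto> E)" using x nonunits by simp
  ultimately have "(\<Otimes>\<^bsub>A \<propto> E\<^esub>i\<in>{1..n}. x i) \<in> I \<or> x (n + 1) \<in> I"
    using OA unfolding OA_ideal_def by blast
  then have "(p, \<zero>\<^bsub>E\<^esub>) \<in> I \<or> (\<zero>\<^bsub>A\<^esub>, e) \<in> I" unfolding prod_x by (simp add: x_def)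
  \<comment> \<open>Multiplication by a unit is injective on \<open>E\<close> and multiplication by \<open>N\<close> is zero, so the
    value of \<open>ce\<close> decides whether \<open>1 - c\<close> or \<open>c\<close> is a unit.\<close>
  then consider c where "c \<in> carrier A" "c \<otimes>\<^bsub>A\<^esub> p = p" "c \<odot>\<^bsub>E\<^esub> e = \<zero>\<^bsub>E\<^esub>"
    | c where "c \<in> carrier A" "c \<otimes>\<^bsub>A\<^esub> p = \<zero>\<^bsub>A\<^esub>" "c \<odot>\<^bsub>E\<^esub> e = e"
    using I_elem[of "(p, \<zero>\<^bsub>E\<^esub>)"] I_elem[of "(\<zero>\<^bsub>A\<^esub>, e)"] unfolding fst_conv snd_conv by blast
  then have "p = \<zero>\<^bsub>A\<^esub>"
  proof cases
    case 1
    have "c \<notin> Units A"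
    proof
      assume c: "c \<in> Units A"
      then have "inv\<^bsub>A\<^esub> c \<odot>\<^bsub>E\<^esub> (c \<odot>\<^bsub>E\<^esub> e) = e"
        using e R.Units_closed[OF c] smult_assoc1[of "inv\<^bsub>A\<^esub> c" c e] by simp
      then show False using 1(3) e c by simp
    qed
    then have cN: "c \<in> N" using 1(1) local_ring_Units[OF local maximal] by auto
    have "\<one>\<^bsub>A\<^esub> \<ominus>\<^bsub>A\<^esub> c \<notin> N"
    proof
      assume "\<one>\<^bsub>A\<^esub> \<ominus>\<^bsub>A\<^esub> c \<in> N"
      then have "(\<one>\<^bsub>A\<^esub> \<ominus>\<^bsub>A\<^esub> c) \<oplus>\<^bsub>A\<^esub> c \<in> N" using cN N.a_closed by blast
      moreover have "(\<one>\<^bsub>A\<^esub> \<ominus>\<^bsub>A\<^esub> c) \<oplus>\<^bsub>A\<^esub> c = \<one>\<^bsub>A\<^esub>" using 1(1) by algebra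
      ultimately show False using one_notin_maximal by simp
    qed
    then have "\<one>\<^bsub>A\<^esub> \<ominus>\<^bsub>A\<^esub> c \<in> Units A"
      using 1(1) local_ring_Units[OF local maximal] by auto
    moreover have "(\<one>\<^bsub>A\<^esub> \<ominus>\<^bsub>A\<^esub> c) \<otimes>\<^bsub>A\<^esub> p = (\<one>\<^bsub>A\<^esub> \<ominus>\<^bsub>A\<^esub> c) \<otimes>\<^bsub>A\<^esub> \<zero>\<^bsub>A\<^esub>"
    proof -
      have "(\<one>\<^bsub>A\<^esub> \<ominus>\<^bsub>A\<^esub> c) \<otimes>\<^bsub>A\<^esub> p = p \<ominus>\<^bsub>A\<^esub> c \<otimes>\<^bsub>A\<^esub> p" using 1(1) p by algebra
      also have "\<dots> = p \<ominus>\<^bsub>A\<^esub> p" using 1(2) by simp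
      also have "\<dots> = (\<one>\<^bsub>A\<^esub> \<ominus>\<^bsub>A\<^esub> c) \<otimes>\<^bsub>A\<^esub> \<zero>\<^bsub>A\<^esub>" using 1(1) p by (simp add: R.minus_eq R.r_neg)
      finally show ?thesis .
    qed
    ultimately show ?thesis using p R.Units_l_cancel by blast
  next
    case 2
    have "c \<notin> N" using 2 e smult_maximal by auto
    then have "c \<in> Units A" using 2(1) local_ring_Units[OF local maximal] by auto
    moreover have "c \<otimes>\<^bsub>A\<^esub> p = c \<otimes>\<^bsub>A\<^esub> \<zero>\<^bsub>A\<^esub>" using 2 by simp
    ultimately show ?thesis using p R.Units_l_cancel by blast
  qed
  then show "(\<Otimes>\<^bsub>A\<^esub>i\<in>{1..n}. a i) = \<zero>\<^bsub>A\<^esub>" unfolding p_def .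
qed

text \<open>
  The first components of \<open>n\<close> nonunits multiply to an element of \<open>N\<^sup>n\<close>; the bound \<open>n \<ge> 2\<close> is what
  makes the second component of the product vanish as well.
\<close>

lemma OA_ideal_of_maximal_power_eq_zero:
  assumes "N [^]\<^bsub>ideals_set A\<^esub> n = {\<zero>\<^bsub>A\<^esub>}" "n \<ge> 2" "proper_ideal I (A \<propto> E)"
  shows "OA_ideal n I (A \<propto> E)"
proof -
  have "(\<Otimes>\<^bsub>A \<propto> E\<^esub>i\<in>{1..n}. x i) \<in> I" if "x \<in> {1..n+1} \<rightarrow> N \<times> carrier E" for x
  proof -
    have x: "x \<in> {1..n} \<rightarrow> N \<times> carrier E" using that by (auto simp: Pi_iff)
    then have "(\<lambda>i. fst (x i)) \<in> {1..n} \<rightarrow> N" by (auto simp: Pi_iff mem_Times_iff)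
    then have "(\<Otimes>\<^bsub>A\<^esub>i\<in>{1..n}. fst (x i)) = \<zero>\<^bsub>A\<^esub>"
      using assms(1) R.ideal_power_eq_zero_iff[OF N.is_ideal] by blast
    then have "(\<Otimes>\<^bsub>A \<propto> E\<^esub>i\<in>{1..n}. x i) = \<zero>\<^bsub>A \<propto> E\<^esub>"
      using fst_finprod[of x n] finprod_nonunits(2)[OF x] assms(2) x N.Icarr
      by (auto simp: prod_eq_iff Pi_iff mem_Times_iff)
    then show ?thesis
      using assms(3) additive_subgroup.zero_closed[OF ideal.axioms(1)]
      by (metis proper_ideal_def)
  qed
  then show ?thesis using assms(3) unfolding OA_ideal_def nonunits by blast
qed

lemma OAF_ring_of_OA_ideals:
  assumes "\<And>I. proper_ideal I (A \<propto> E) \<Longrightarrow> OA_ideal n I (A \<propto> E)"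
  shows "OAF_ring n (A \<propto> E)"
  unfolding OAF_ring_def
proof (intro conjI allI impI)
  interpret S: comm_monoid "ideals_set (A \<propto> E)" by (rule T.ideals_set_is_comm_monoid)
  show "cring (A \<propto> E)" by (rule T.is_cring)
  show "\<one>\<^bsub>A \<propto> E\<^esub> \<noteq> \<zero>\<^bsub>A \<propto> E\<^esub>" using one_not_zero by simp
  fix I assume I: "proper_ideal I (A \<propto> E)"
  then have "I \<in> carrier (ideals_set (A \<propto> E))" by (simp add: ideals_set_simps proper_ideal_def)
  then have "I = (\<Otimes>\<^bsub>ideals_set (A \<propto> E)\<^esub>i\<in>{1..1::nat}. I)" by simp
  then show "\<exists>(k::nat) J. (\<forall>i\<in>{1..k}. OA_ideal n (J i) (A \<propto> E)) \<and>
      I = (\<Otimes>\<^bsub>ideals_set (A \<propto> E)\<^esub>i\<in>{1..k}. J i)"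
    using assms[OF I] by (intro exI[of _ 1] exI[of _ "\<lambda>_. I"]) simp
qed

end

theorem corollary4p7:
  fixes A :: "('a, 'm) ring_scheme"
    and E :: "('a, 'e, 'k) module_scheme"
    and M :: "'a set"
    and n :: nat
  assumes "local_ring A"
    and "maximalideal M A"
    and "module A E"
    and "carrier E \<noteq> {\<zero>\<^bsub>E\<^esub>}"
    and "\<forall>m\<in>M. \<forall>e\<in>carrier E. m \<odot>\<^bsub>E\<^esub> e = \<zero>\<^bsub>E\<^esub>"
    and "n > 0"
  shows "(OAF_ring n (A \<propto> E) \<longrightarrow> M [^]\<^bsub>ideals_set A\<^esub> n = {\<zero>\<^bsub>A\<^esub>}) \<and>
         (n \<ge> 2 \<longrightarrow> M [^]\<^bsub>ideals_set A\<^esub> n = {\<zero>\<^bsub>A\<^esub>} \<longrightarrow>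
            (\<forall>I. proper_ideal I (A \<propto> E) \<longrightarrow> OA_ideal n I (A \<propto> E))) \<and>
         ((\<forall>I. proper_ideal I (A \<propto> E) \<longrightarrow> OA_ideal n I (A \<propto> E)) \<longrightarrow> OAF_ring n (A \<propto> E))"
proof -
  interpret local_trivial_extension A E M
    using assms by (auto simp: local_trivial_extension_def local_trivial_extension_axioms_def)
  show ?thesis
    using maximal_power_eq_zero_of_OAF_ring[of n] OA_ideal_of_maximal_power_eq_zero[of n]
      OAF_ring_of_OA_ideals[of n] assms(4,6)
    by blast
qed

end
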